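(* Consider the convex problem $p^\star=\inf_{x\in\mathbb{R}^n}\{f_0(x): f_i(x)\le 0,\ i=1,\dots,m,\ Ax=b\}$ with an optimal solution $x^\star$. Assume that (i) the norms of the subgradients of $f_0,f_1,\dots,f_m$ and the values of $f_1,\dots,f_m$ are bounded on every compact subset of $\mathbb{R}^n$, and (ii) strong duality holds: $p^\star=d^\star$ and the dual problem $d^\star=\sup_{\lambda\in\mathbb{R}^m_+,\,\nu\in\mathbb{R}^l}\inf_{x\in\mathbb{R}^n}L(x,\lambda,\nu)$ has an optimal solution $(\lambda^\star,\nu^\star)$. Let $s\in[1,2]$, $\rho>0$, $\delta\in(0,1)$, and let $(x^{(k)})_{k\ge0}$ be generated by the primal-dual subgradient method (PDS) with step sizes $$\alpha_k=\frac{\gamma_k}{\|T^{(k)}\|_2},\qquad \gamma_k=(k+1)^{-1+\delta/2},$$ where $T^{(k)}\ne0$ for all $k$. For $\varepsilon>0$ and $K\in\mathbb{N}$ let $$\mathcal{I}_\varepsilon(K):=\{k\in\{0,1,\dots,K\}:\|F(x^{(k)})\|_2+\|Ax^{(k)}-b\|_2\le\varepsilon\},\qquad p^{(K)}_\varepsilon:=\min_{k\in\mathcal{I}_\varepsilon(K)}f_0(x^{(k)}).$$ Then there is a constant $c>0$, independent of $\varepsilon$ and $K$, such that for every $\varepsilon>0$ and every integer $K\ge c\,\varepsilon^{-2s/\delta}$, $$\mathcal{I}_\varepsilon(K)\neq\emptyset\qquad\text{and}\qquad p^{(K)}_\varepsilon\le p^\star+\varepsilon .$$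
   Context: Data: $f_0,f_1,\dots,f_m:\mathbb{R}^n\to\mathbb{R}$ are convex (possibly nondifferentiable), $A\in\mathbb{R}^{l\times n}$, $b\in\mathbb{R}^l$. An optimal solution $x^\star$ satisfies $f_i(x^\star)\le0$ for $i=1,\dots,m$, $Ax^\star=b$, $f_0(x^\star)=p^\star$. $F(x):=(F_1(x),\dots,F_m(x))$ with $F_i(x)=\max\{f_i(x),0\}$. Lagrangian: $L(x,\lambda,\nu)=f_0(x)+\lambda^\top F(x)+\nu^\top(Ax-b)$ for $x\in\mathbb{R}^n,\lambda\in\mathbb{R}^m_+,\nu\in\mathbb{R}^l$. $\partial$ denotes the convex subdifferential. PDS method (parameters $s\in[1,2]$, $\rho>0$): choose $x^{(0)}\in\mathbb{R}^n$, $\lambda^{(0)}\in\mathbb{R}^m_+$, $\nu^{(0)}\in\mathbb{R}^l$. For $k=0,1,2,\dots$, write $F^{(k)}=F(x^{(k)})$, pick any $g_0^{(k)}\in\partial f_0(x^{(k)})$ and $g_i^{(k)}\in\partial F_i(x^{(k)})$, $i=1,\dots,m$, and set 1. $\varrho^{(k)}=s\|F^{(k)}\|_2^{s-2}F^{(k)}$ if $F^{(k)}\ne0$, and $\varrho^{(k)}=0$ otherwise; 2. $\varsigma^{(k)}=s\|Ax^{(k)}-b\|_2^{s-2}(Ax^{(k)}-b)$ if $Ax^{(k)}\neq b$, and $\varsigma^{(k)}=0$ otherwise; 3. $x^{(k+1)}=x^{(k)}-\alpha_k\big[g_0^{(k)}+\sum_{i=1}^m(\lambda_i^{(k)}+\rho\varrho_i^{(k)})g_i^{(k)}+A^\top(\nu^{(k)}+\rho\varsigma^{(k)})\big]$;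 4. $\lambda^{(k+1)}=\lambda^{(k)}+\alpha_kF^{(k)}$ and $\nu^{(k+1)}=\nu^{(k)}+\alpha_k(Ax^{(k)}-b)$. Here $T^{(k)}\in\mathbb{R}^{n+m+l}$ is the vector with blocks $g_0^{(k)}+\sum_{i=1}^m(\lambda_i^{(k)}+\rho\varrho_i^{(k)})g_i^{(k)}+A^\top(\nu^{(k)}+\rho\varsigma^{(k)})$, $-F^{(k)}$, and $b-Ax^{(k)}$; so, with $z^{(k)}=(x^{(k)},\lambda^{(k)},\nu^{(k)})$, the iteration is $z^{(k+1)}=z^{(k)}-\alpha_kT^{(k)}$. *)

theory Defs
  imports "HOL-Analysis.Analysis"
begin

definition subdifferential :: "('a::real_inner \<Rightarrow> real) \<Rightarrow> 'a \<Rightarrow> 'a set" where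
  "subdifferential h x = {g. \<forall>y. h y \<ge> h x + g \<bullet> (y - x)}"

definition subgradients_bounded_on_compacts :: "('a::real_inner \<Rightarrow> real) \<Rightarrow> bool" where
  "subgradients_bounded_on_compacts h \<longleftrightarrow>
     (\<forall>C. compact C \<longrightarrow> (\<exists>B. \<forall>x\<in>C. \<forall>g\<in>subdifferential h x. norm g \<le> B))"

definition values_bounded_on_compacts :: "('a::real_inner \<Rightarrow> real) \<Rightarrow> bool" where
  "values_bounded_on_compacts h \<longleftrightarrow> (\<forall>C. compact C \<longrightarrow> bounded (h ` C))"


text \<open>
  The optimal values are extended reals, so that the dual function may take the value
  minus infinity.
\<close>

definition feasible_set ::
  "('m::finite \<Rightarrow> real^'n \<Rightarrow> real) \<Rightarrow> real^'n^'l \<Rightarrow> real^'l \<Rightarrow> (real^'n) set" where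
  "feasible_set f A b = {x. (\<forall>i. f i x \<le> 0) \<and> A *v x = b}"

definition primal_value ::
  "(real^'n \<Rightarrow> real) \<Rightarrow> ('m::finite \<Rightarrow> real^'n \<Rightarrow> real) \<Rightarrow> real^'n^'l \<Rightarrow> real^'l \<Rightarrow> ereal" where
  "primal_value f0 f A b = (INF x\<in>feasible_set f A b. ereal (f0 x))"

definition primal_optimal ::
  "(real^'n \<Rightarrow> real) \<Rightarrow> ('m::finite \<Rightarrow> real^'n \<Rightarrow> real) \<Rightarrow> real^'n^'l \<Rightarrow> real^'l
    \<Rightarrow> real^'n \<Rightarrow> bool" where
  "primal_optimal f0 f A b x \<longleftrightarrow>
     x \<in> feasible_set f A b \<and> ereal (f0 x) = primal_value f0 f A b"

definition Fplus :: "('m::finite \<Rightarrow> real^'n \<Rightarrow> real) \<Rightarrow> real^'n \<Rightarrow> real^'m" where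
  "Fplus f x = (\<chi> i. max (f i x) 0)"

definition Lagrangian ::
  "(real^'n \<Rightarrow> real) \<Rightarrow> ('m::finite \<Rightarrow> real^'n \<Rightarrow> real) \<Rightarrow> real^'n^'l \<Rightarrow> real^'l
    \<Rightarrow> real^'n \<Rightarrow> real^'m \<Rightarrow> real^'l \<Rightarrow> real" where
  "Lagrangian f0 f A b x lam nu = f0 x + lam \<bullet> Fplus f x + nu \<bullet> (A *v x - b)"

definition dual_function ::
  "(real^'n \<Rightarrow> real) \<Rightarrow> ('m::finite \<Rightarrow> real^'n \<Rightarrow> real) \<Rightarrow> real^'n^'l \<Rightarrow> real^'l
    \<Rightarrow> real^'m \<Rightarrow> real^'l \<Rightarrow> ereal" where
  "dual_function f0 f A b lam nu = (INF x. ereal (Lagrangian f0 f A b x lam nu))"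

definition nonneg_orthant :: "(real^'m) set" where
  "nonneg_orthant = {lam. \<forall>i. 0 \<le> lam $ i}"

definition dual_value ::
  "(real^'n \<Rightarrow> real) \<Rightarrow> ('m::finite \<Rightarrow> real^'n \<Rightarrow> real) \<Rightarrow> real^'n^'l \<Rightarrow> real^'l \<Rightarrow> ereal" where
  "dual_value f0 f A b = (SUP lam\<in>nonneg_orthant. SUP nu. dual_function f0 f A b lam nu)"

definition dual_optimal ::
  "(real^'n \<Rightarrow> real) \<Rightarrow> ('m::finite \<Rightarrow> real^'n \<Rightarrow> real) \<Rightarrow> real^'n^'l \<Rightarrow> real^'l
    \<Rightarrow> real^'m \<Rightarrow> real^'l \<Rightarrow> bool" where
  "dual_optimal f0 f A b lam nu \<longleftrightarrow>
     lam \<in> nonneg_orthant \<and> dual_function f0 f A b lam nu = dual_value f0 f A b"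


text \<open>
  Both penalty vectors, for the inequality and for the equality constraints, are values of
  the following map (at \<open>Fplus f x\<close> and at \<open>A *v x - b\<close>).
\<close>

definition penalty_dir :: "real \<Rightarrow> 'a::real_normed_vector \<Rightarrow> 'a" where
  "penalty_dir s v = (if v = 0 then 0 else (s * norm v powr (s - 2)) *\<^sub>R v)"

text \<open>
  The vector with three blocks is an element of a product type, whose norm is the Euclidean
  norm of the concatenated vector. The argument \<open>g0\<close> is the subgradient of the objective at
  \<open>x\<close>, and \<open>g i\<close> that of the \<open>i\<close>-th component of \<open>Fplus f\<close>.
\<close>

definition pds_T ::
  "('m::finite \<Rightarrow> real^'n \<Rightarrow> real) \<Rightarrow> real^'n^'l \<Rightarrow> real^'l \<Rightarrow> real \<Rightarrow> real
    \<Rightarrow> real^'n \<Rightarrow> real^'m \<Rightarrow> real^'l \<Rightarrow> real^'n \<Rightarrow> ('m \<Rightarrow> real^'n)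
    \<Rightarrow> (real^'n) \<times> (real^'m) \<times> (real^'l)" where
  "pds_T f A b s \<rho> x lam nu g0 g =
     (g0 + (\<Sum>i\<in>UNIV. (lam $ i + \<rho> * penalty_dir s (Fplus f x) $ i) *\<^sub>R g i)
         + transpose A *v (nu + \<rho> *\<^sub>R penalty_dir s (A *v x - b)),
      - Fplus f x,
      b - A *v x)"

definition pds_sequence ::
  "(real^'n \<Rightarrow> real) \<Rightarrow> ('m::finite \<Rightarrow> real^'n \<Rightarrow> real) \<Rightarrow> real^'n^'l \<Rightarrow> real^'l
    \<Rightarrow> real \<Rightarrow> real \<Rightarrow> (nat \<Rightarrow> real)
    \<Rightarrow> (nat \<Rightarrow> real^'n) \<Rightarrow> (nat \<Rightarrow> real^'m) \<Rightarrow> (nat \<Rightarrow> real^'l)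
    \<Rightarrow> (nat \<Rightarrow> real^'n) \<Rightarrow> (nat \<Rightarrow> 'm \<Rightarrow> real^'n) \<Rightarrow> bool" where
  "pds_sequence f0 f A b s \<rho> \<alpha> x lam nu g0 g \<longleftrightarrow>
     lam 0 \<in> nonneg_orthant \<and>
     (\<forall>k. g0 k \<in> subdifferential f0 (x k)) \<and>
     (\<forall>k i. g k i \<in> subdifferential (\<lambda>y. Fplus f y $ i) (x k)) \<and>
     (\<forall>k. (x (Suc k), lam (Suc k), nu (Suc k)) =
          (x k, lam k, nu k) - \<alpha> k *\<^sub>R pds_T f A b s \<rho> (x k) (lam k) (nu k) (g0 k) (g k))"

definition near_feasible_indices ::
  "('m::finite \<Rightarrow> real^'n \<Rightarrow> real) \<Rightarrow> real^'n^'l \<Rightarrow> real^'l \<Rightarrow> (nat \<Rightarrow> real^'n)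
    \<Rightarrow> real \<Rightarrow> nat \<Rightarrow> nat set" where
  "near_feasible_indices f A b x \<epsilon> K =
     {k \<in> {0..K}. norm (Fplus f (x k)) + norm (A *v x k - b) \<le> \<epsilon>}"

text \<open>Meaningful only when the index set is nonempty: \<open>Min {}\<close> is unspecified.\<close>

definition best_value ::
  "(real^'n \<Rightarrow> real) \<Rightarrow> ('m::finite \<Rightarrow> real^'n \<Rightarrow> real) \<Rightarrow> real^'n^'l \<Rightarrow> real^'l
    \<Rightarrow> (nat \<Rightarrow> real^'n) \<Rightarrow> real \<Rightarrow> nat \<Rightarrow> real" where
  "best_value f0 f A b x \<epsilon> K = Min ((\<lambda>k. f0 (x k)) ` near_feasible_indices f A b x \<epsilon> K)"

end

theory Submission
  imports Defs
begin

text \<open>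
  Write \<open>z = (x, lam, nu)\<close>, \<open>w = (xstar, lamstar, nustar)\<close> and \<open>D k = T k \<bullet> (z k - w)\<close>. The
  subgradient inequalities and strong duality show that \<open>D k\<close> dominates
  \<open>\<rho> s (norm F powr s + norm (A x - b) powr s)\<close> plus the nonnegative Lagrangian gap
  \<open>L x lamstar nustar - p\<close>. Expanding
  \<open>norm (z (k + 1) - w)\<^sup>2\<close> and telescoping, square summability of \<open>\<gamma>\<close> bounds the iterates, hence
  the \<open>T k\<close>, and also \<open>\<Sum>k. \<gamma> k * D k / norm (T k)\<close>. Since \<open>\<gamma> 0 + \<dots> + \<gamma> K\<close> is at least
  \<open>(K + 1) powr (\<delta> / 2)\<close>, some \<open>k \<le> K\<close> has \<open>D k\<close> of order \<open>K powr (- \<delta> / 2)\<close>; its residual is then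
  of order \<open>K powr (- \<delta> / (2 * s))\<close>, and so is its objective gap.
\<close>

section \<open>Penalty directions and positive parts\<close>

lemma penalty_dir_inner_self:
  fixes v :: "'a::real_inner"
  shows "penalty_dir s v \<bullet> v = s * norm v powr s"
proof (cases "v = 0")
  case False
  have "norm v powr s = norm v powr (s - 2) * norm v powr 2"
    using powr_add[of "norm v" "s - 2" 2] by simp
  also have "norm v powr 2 = v \<bullet> v"
    using False by (simp add: dot_square_norm)
  finally show ?thesis
    using False by (simp add: penalty_dir_def)
qed (simp add: penalty_dir_def)

text \<open>For nonzero \<open>v\<close> the norm is \<open>s * norm v powr (s - 1)\<close> with
  \<open>s - 1\<close> in the unit interval. Replacing \<open>norm v\<close> by
  \<open>1 + norm v\<close> gives a base of at least 1, so that the exponent can be raised to 1 even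
  for small \<open>v\<close>.\<close>

lemma norm_penalty_dir_le:
  assumes "s \<in> {1..2}"
  shows "norm (penalty_dir s v) \<le> 2 * (1 + norm v)"
proof (cases "v = 0")
  case False
  have "norm v powr (s - 1) = norm v powr (s - 2) * norm v powr 1"
    using powr_add[of "norm v" "s - 2" 1] by simp
  then have eq: "norm (penalty_dir s v) = s * norm v powr (s - 1)"
    using False assms by (simp add: penalty_dir_def)
  have "norm v powr (s - 1) \<le> (1 + norm v) powr (s - 1)"
    using assms by (intro powr_mono2) auto
  also have "\<dots> \<le> (1 + norm v) powr 1"
    using assms by (intro powr_mono) auto
  finally have "norm v powr (s - 1) \<le> 1 + norm v"
    by simp
  then show ?thesis
    unfolding eq using assms by (intro mult_mono) auto
qed (simp add: penalty_dir_def)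

lemma penalty_dir_component_nonneg:
  fixes v :: "real^'m"
  assumes "0 \<le> s" "0 \<le> v $ i"
  shows "0 \<le> penalty_dir s v $ i"
  using assms by (simp add: penalty_dir_def)

lemma Fplus_nonneg: "0 \<le> Fplus f x $ i"
  by (simp add: Fplus_def)

lemma Fplus_eq_0_iff: "Fplus f x = 0 \<longleftrightarrow> (\<forall>i. f i x \<le> 0)"
  by (auto simp: Fplus_def vec_eq_iff max_def)

section \<open>Lower bound for the inner product of the direction with the error\<close>

lemma lagrangian_ge_primal_optimum:
  assumes "primal_optimal f0 f A b xstar"
    and "primal_value f0 f A b = dual_value f0 f A b"
    and "dual_optimal f0 f A b lamstar nustar"
  shows "f0 xstar \<le> Lagrangian f0 f A b x lamstar nustar"
proof -
  have "ereal (f0 xstar) = dual_function f0 f A b lamstar nustar"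
    using assms by (simp add: primal_optimal_def dual_optimal_def)
  also have "\<dots> \<le> ereal (Lagrangian f0 f A b x lamstar nustar)"
    unfolding dual_function_def by (rule INF_lower) simp
  finally show ?thesis
    by simp
qed

text \<open>Every subgradient inequality is tested at \<open>xstar\<close>, where
  \<open>Fplus f\<close> vanishes; those for \<open>Fplus f\<close> are weighted by nonnegative
  multipliers, and the equality block is moved through the adjoint of \<open>A\<close>. The terms in
  \<open>lam\<close> and \<open>nu\<close> then cancel against the two dual blocks, which leaves the
  multipliers \<open>lamstar\<close> and \<open>nustar\<close> of the Lagrangian. Each penalty
  direction paired with its own argument gives a power \<open>s\<close>.\<close>

lemma pds_T_inner_ge:
  assumes feas: "xstar \<in> feasible_set f A b"
    and g0: "g0 \<in> subdifferential f0 x"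
    and g: "\<And>i. g i \<in> subdifferential (\<lambda>y. Fplus f y $ i) x"
    and lam: "lam \<in> nonneg_orthant" and "0 \<le> s" "0 \<le> \<rho>"
  shows "Lagrangian f0 f A b x lamstar nustar - f0 xstar
           + \<rho> * s * (norm (Fplus f x) powr s + norm (A *v x - b) powr s)
         \<le> pds_T f A b s \<rho> x lam nu g0 g \<bullet> ((x, lam, nu) - (xstar, lamstar, nustar))"
proof -
  define F where "F = Fplus f x"
  define r where "r = A *v x - b"
  define P where "P = penalty_dir s F"
  define Q where "Q = penalty_dir s r"
  have F_star: "Fplus f xstar = 0" and A_star: "A *v xstar = b"
    using feas by (auto simp: feasible_set_def Fplus_eq_0_iff)
  have g0_ge: "f0 x - f0 xstar \<le> g0 \<bullet> (x - xstar)"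
    using g0[unfolded subdifferential_def, THEN CollectD, THEN spec, of xstar]
    by (simp add: inner_diff_right)
  have g_ge: "F $ i \<le> g i \<bullet> (x - xstar)" for i
    using g[of i, unfolded subdifferential_def, THEN CollectD, THEN spec, of xstar]
    by (simp add: inner_diff_right F_star F_def)
  have weight: "0 \<le> lam $ i + \<rho> * P $ i" for i
    using assms penalty_dir_component_nonneg[of s F i]
    by (simp add: nonneg_orthant_def P_def F_def Fplus_nonneg)
  have "(lam + \<rho> *\<^sub>R P) \<bullet> F = (\<Sum>i\<in>UNIV. (lam $ i + \<rho> * P $ i) * F $ i)"
    by (simp add: inner_vec_def)
  also have "\<dots> \<le> (\<Sum>i\<in>UNIV. (lam $ i + \<rho> * P $ i) * (g i \<bullet> (x - xstar)))"
    by (intro sum_mono mult_left_mono g_ge weight)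
  also have "\<dots> = (\<Sum>i\<in>UNIV. (lam $ i + \<rho> * P $ i) *\<^sub>R g i) \<bullet> (x - xstar)"
    by (simp add: inner_sum_left)
  finally have ineq_ge: "lam \<bullet> F + \<rho> * (P \<bullet> F) \<le> \<dots>"
    by (simp add: inner_add_left)
  have "(transpose A *v (nu + \<rho> *\<^sub>R Q)) \<bullet> (x - xstar) = (nu + \<rho> *\<^sub>R Q) \<bullet> (A *v (x - xstar))"
    by (metis dot_lmul_matrix vector_transpose_matrix transpose_transpose)
  also have "A *v (x - xstar) = r"
    by (simp add: matrix_vector_mult_diff_distrib A_star r_def)
  finally have eq_part: "(transpose A *v (nu + \<rho> *\<^sub>R Q)) \<bullet> (x - xstar) = nu \<bullet> r + \<rho> * (Q \<bullet> r)"
    by (simp add: inner_add_left)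
  have PF: "P \<bullet> F = s * norm F powr s" and Qr: "Q \<bullet> r = s * norm r powr s"
    by (simp_all add: P_def Q_def penalty_dir_inner_self)
  have "pds_T f A b s \<rho> x lam nu g0 g \<bullet> ((x, lam, nu) - (xstar, lamstar, nustar))
      = g0 \<bullet> (x - xstar) + (\<Sum>i\<in>UNIV. (lam $ i + \<rho> * P $ i) *\<^sub>R g i) \<bullet> (x - xstar)
        + (transpose A *v (nu + \<rho> *\<^sub>R Q)) \<bullet> (x - xstar) - F \<bullet> (lam - lamstar) - r \<bullet> (nu - nustar)"
    by (simp add: pds_T_def F_def r_def P_def Q_def inner_add_left inner_diff_left)
  also have "\<dots> \<ge> f0 x - f0 xstar + (lam \<bullet> F + \<rho> * (P \<bullet> F)) + (nu \<bullet> r + \<rho> * (Q \<bullet> r))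
      - F \<bullet> (lam - lamstar) - r \<bullet> (nu - nustar)"
    using g0_ge ineq_ge eq_part by linarith
  also have "f0 x - f0 xstar + (lam \<bullet> F + \<rho> * (P \<bullet> F)) + (nu \<bullet> r + \<rho> * (Q \<bullet> r))
      - F \<bullet> (lam - lamstar) - r \<bullet> (nu - nustar)
      = Lagrangian f0 f A b x lamstar nustar - f0 xstar
        + \<rho> * s * (norm F powr s + norm r powr s)"
    unfolding PF Qr
    by (simp add: Lagrangian_def inner_diff_right inner_commute algebra_simps flip: F_def r_def)
  finally show ?thesis
    by (simp add: F_def r_def)
qed

section \<open>Boundedness of the direction on bounded sets\<close>

text \<open>Moving from \<open>x\<close> along the unit vector \<open>sgn g\<close> raises the
  affine minorant by \<open>norm g\<close>, whereas \<open>h\<close> can rise by at most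
  \<open>2 * B\<close>. If \<open>g = 0\<close>, then \<open>sgn g = 0\<close> and the same
  computation applies.\<close>

lemma subgradient_norm_le:
  assumes "g \<in> subdifferential h x" and "\<And>y. dist x y \<le> 1 \<Longrightarrow> \<bar>h y\<bar> \<le> B"
  shows "norm g \<le> 2 * B"
proof -
  have "h x + g \<bullet> (x + sgn g - x) \<le> h (x + sgn g)"
    using assms(1) unfolding subdifferential_def by blast
  moreover have "g \<bullet> sgn g = norm g"
    by (cases "g = 0") (simp_all add: sgn_div_norm dot_square_norm power2_eq_square)
  moreover have "\<bar>h x\<bar> \<le> B" "\<bar>h (x + sgn g)\<bar> \<le> B"
    by (auto intro!: assms(2) simp: dist_norm norm_sgn)
  ultimately show ?thesis
    by simp
qed

lemma Fplus_bounded_on_cball: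
  fixes f :: "'m::finite \<Rightarrow> real^'n \<Rightarrow> real"
  assumes "\<And>i. values_bounded_on_compacts (f i)"
  obtains B where "\<And>x. norm x \<le> R \<Longrightarrow> norm (Fplus f x) \<le> B"
proof -
  have "\<exists>B. \<forall>x\<in>cball 0 R. norm (f i x) \<le> B" for i
    using assms[of i, unfolded values_bounded_on_compacts_def, rule_format, of "cball 0 R"]
    by (auto simp: bounded_iff)
  then obtain B where B: "\<And>i x. norm x \<le> R \<Longrightarrow> \<bar>f i x\<bar> \<le> B i"
    by (metis mem_cball_0 real_norm_def)
  have "norm (Fplus f x) \<le> (\<Sum>i\<in>UNIV. B i)" if "norm x \<le> R" for x
  proof -
    have "norm (Fplus f x) \<le> (\<Sum>i\<in>UNIV. \<bar>Fplus f x $ i\<bar>)"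
      by (rule norm_le_l1_cart)
    also have "\<dots> \<le> (\<Sum>i\<in>UNIV. B i)"
    proof (rule sum_mono)
      fix i
      show "\<bar>Fplus f x $ i\<bar> \<le> B i"
        using B[OF that, of i] by (auto simp: Fplus_def max_def)
    qed
    finally show ?thesis .
  qed
  then show thesis
    using that by blast
qed

text \<open>One \<open>M\<close> serves all points in the ball and all choices of subgradients. The
  subgradients of the components of \<open>Fplus f\<close> are controlled by the values of
  \<open>Fplus f\<close> on the ball of radius \<open>R + 1\<close>, the extra 1 being room for a
  unit step.\<close>

lemma pds_T_bounded:
  fixes f :: "'m::finite \<Rightarrow> real^'n \<Rightarrow> real"
  assumes "subgradients_bounded_on_compacts f0" "\<And>i. values_bounded_on_compacts (f i)"
    and s: "s \<in> {1..2}" and \<rho>: "0 \<le> \<rho>" and R: "0 \<le> R"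
  shows "\<exists>M>0. \<forall>x lam nu g0 g. norm x \<le> R \<longrightarrow> norm lam \<le> R \<longrightarrow> norm nu \<le> R \<longrightarrow>
    g0 \<in> subdifferential f0 x \<longrightarrow> (\<forall>i. g i \<in> subdifferential (\<lambda>y. Fplus f y $ i) x) \<longrightarrow>
    norm (pds_T f A b s \<rho> x lam nu g0 g) \<le> M"
proof -
  obtain B where F_le: "\<And>x. norm x \<le> R + 1 \<Longrightarrow> norm (Fplus f x) \<le> B"
    using Fplus_bounded_on_cball assms(2) by blast
  then have "0 \<le> B"
    using R by (intro order_trans[OF norm_ge_zero, of "Fplus f 0"]) simp
  obtain G0 where "\<forall>x\<in>cball 0 R. \<forall>g0\<in>subdifferential f0 x. norm g0 \<le> G0"
    using assms(1)[unfolded subgradients_bounded_on_compacts_def, rule_format, of "cball 0 R"]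
    by auto
  then have G0: "norm g0 \<le> G0" if "norm x \<le> R" "g0 \<in> subdifferential f0 x" for x g0
    using that by simp
  have g_le: "norm h \<le> 2 * B"
    if "norm x \<le> R" "h \<in> subdifferential (\<lambda>y. Fplus f y $ i) x" for x h i
  proof (rule subgradient_norm_le[OF that(2)])
    fix y assume "dist x y \<le> 1"
    then have "norm y \<le> R + 1"
      using that(1) by norm
    then show "\<bar>Fplus f y $ i\<bar> \<le> B"
      by (meson F_le component_le_norm_cart order_trans)
  qed
  obtain a where a: "a > 0" "\<And>v. norm (A *v v) \<le> norm v * a"
    using bounded_linear.pos_bounded[OF matrix_vector_mul_bounded_linear] by blast
  obtain a' where a': "a' > 0" "\<And>v. norm (transpose A *v v) \<le> norm v * a'"
    using bounded_linear.pos_bounded[OF matrix_vector_mul_bounded_linear] by blast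
  \<comment> \<open>\<open>r\<close> bounds the equality residual and \<open>W\<close> each weight
    of a subgradient of \<open>Fplus f\<close>. \<open>M\<close> adds up the bounds for the three
    summands of the first block and for the other two blocks; its last 1 makes it positive.\<close>
  define r where "r = R * a + norm b"
  define W where "W = R + \<rho> * (2 * (1 + B))"
  define M where "M = \<bar>G0\<bar> + real CARD('m) * (W * (2 * B))
    + (R + \<rho> * (2 * (1 + r))) * a' + B + r + 1"
  have "0 \<le> r" "0 \<le> W"
    using a \<rho> R \<open>0 \<le> B\<close> by (simp_all add: r_def W_def)
  then have "M > 0"
    using a' \<rho> R \<open>0 \<le> B\<close> by (simp add: M_def add_nonneg_pos)
  moreover have "norm (pds_T f A b s \<rho> x lam nu g0 g) \<le> M"
    if x: "norm x \<le> R" and lam: "norm lam \<le> R" and nu: "norm nu \<le> R"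
      and g0: "g0 \<in> subdifferential f0 x"
      and g: "\<And>i. g i \<in> subdifferential (\<lambda>y. Fplus f y $ i) x" for x lam nu g0 g
  proof -
    define F where "F = Fplus f x"
    define y where "y = A *v x - b"
    have F: "norm F \<le> B"
      using x F_le[of x] by (simp add: F_def)
    have "norm (A *v x) \<le> R * a"
      using a x by (intro order_trans[OF a(2)] mult_right_mono) auto
    then have y: "norm y \<le> r"
      unfolding y_def r_def using norm_triangle_ineq4[of "A *v x" b] by linarith
    have weight: "\<bar>lam $ i + \<rho> * penalty_dir s F $ i\<bar> \<le> W" for i
    proof -
      have "\<bar>lam $ i\<bar> \<le> R"
        using component_le_norm_cart[of lam i] lam by linarith
      moreover have "norm (penalty_dir s F) \<le> 2 * (1 + B)"
        using F by (intro order_trans[OF norm_penalty_dir_le[OF s]]) simp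
      then have "\<bar>penalty_dir s F $ i\<bar> \<le> 2 * (1 + B)"
        by (rule order_trans[OF component_le_norm_cart])
      then have "\<bar>\<rho> * penalty_dir s F $ i\<bar> \<le> \<rho> * (2 * (1 + B))"
        using \<rho> by (simp add: abs_mult mult_left_mono)
      ultimately show ?thesis
        unfolding W_def by linarith
    qed
    have "norm (\<Sum>i\<in>UNIV. (lam $ i + \<rho> * penalty_dir s F $ i) *\<^sub>R g i)
        \<le> (\<Sum>i::'m\<in>UNIV. W * (2 * B))"
      by (intro sum_norm_le)
        (simp, intro mult_mono weight g_le[OF x g], auto simp: \<open>0 \<le> W\<close>)
    then have sum_le: "norm (\<Sum>i\<in>UNIV. (lam $ i + \<rho> * penalty_dir s F $ i) *\<^sub>R g i)
        \<le> real CARD('m) * (W * (2 * B))"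
      by simp
    have "norm (nu + \<rho> *\<^sub>R penalty_dir s y) \<le> norm nu + \<rho> * norm (penalty_dir s y)"
      using norm_triangle_ineq[of nu "\<rho> *\<^sub>R penalty_dir s y"] \<rho> by simp
    also have "\<dots> \<le> R + \<rho> * (2 * (1 + r))"
      using nu y \<rho> norm_penalty_dir_le[OF s, of y] by (intro add_mono mult_left_mono) auto
    finally have A_le: "norm (transpose A *v (nu + \<rho> *\<^sub>R penalty_dir s y))
        \<le> (R + \<rho> * (2 * (1 + r))) * a'"
      using a' by (meson less_imp_le mult_right_mono order_trans)
    define u where "u = g0 + (\<Sum>i\<in>UNIV. (lam $ i + \<rho> * penalty_dir s F $ i) *\<^sub>R g i)
      + transpose A *v (nu + \<rho> *\<^sub>R penalty_dir s y)"
    have "norm u \<le> norm g0 + norm (\<Sum>i\<in>UNIV. (lam $ i + \<rho> * penalty_dir s F $ i) *\<^sub>R g i)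
      + norm (transpose A *v (nu + \<rho> *\<^sub>R penalty_dir s y))"
      unfolding u_def by norm
    moreover have "pds_T f A b s \<rho> x lam nu g0 g = (u, - F, - y)"
      by (simp add: pds_T_def u_def F_def y_def)
    then have "norm (pds_T f A b s \<rho> x lam nu g0 g) \<le> norm u + (norm F + norm y)"
      using norm_Pair_le[of u "(- F, - y)"] norm_Pair_le[of "- F" "- y"] by simp
    ultimately show ?thesis
      using G0[OF x g0] sum_le A_le F y unfolding M_def by linarith
  qed
  ultimately show ?thesis
    by blast
qed

section \<open>Normalized steps in an inner product space\<close>

text \<open>Step \<open>k\<close> has length exactly \<open>\<bar>\<gamma> k\<bar>\<close>, so the
  quadratic term in the expansion of the squared distance to \<open>w\<close> is
  \<open>(\<gamma> k)\<^sup>2\<close>, whatever the size of \<open>T k\<close>.\<close>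

lemma normalized_step_telescope:
  fixes z T :: "nat \<Rightarrow> 'a::real_inner"
  assumes step: "\<And>k. z (Suc k) = z k - (\<gamma> k / norm (T k)) *\<^sub>R T k" and "\<And>k. T k \<noteq> 0"
  shows "(norm (z n - w))\<^sup>2 + 2 * (\<Sum>k<n. \<gamma> k * (T k \<bullet> (z k - w)) / norm (T k))
       = (norm (z 0 - w))\<^sup>2 + (\<Sum>k<n. (\<gamma> k)\<^sup>2)"
proof (induction n)
  case (Suc n)
  define t where "t = \<gamma> n / norm (T n)"
  have "(norm (z (Suc n) - w))\<^sup>2 = (norm ((z n - w) - t *\<^sub>R T n))\<^sup>2"
    by (simp add: step t_def algebra_simps)
  also have "\<dots> = (norm (z n - w))\<^sup>2 - 2 * t * (T n \<bullet> (z n - w)) + t\<^sup>2 * (norm (T n))\<^sup>2"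
    unfolding power2_norm_eq_inner
    by (simp add: inner_diff_left inner_diff_right inner_commute power2_eq_square algebra_simps)
  also have "t\<^sup>2 * (norm (T n))\<^sup>2 = (\<gamma> n)\<^sup>2"
    using assms(2)[of n] by (simp add: t_def power_divide)
  finally show ?case
    using Suc by (simp add: t_def)
qed simp

text \<open>The index minimizing the inner product over \<open>{..K}\<close> works: each telescoped
  summand is at least \<open>\<gamma> j / M\<close> times the minimum, because
  \<open>norm (T j)\<close> is at most \<open>M\<close>, and the sum is at most
  \<open>S / 2\<close>.\<close>

lemma normalized_step_min_inner_le:
  fixes z T :: "nat \<Rightarrow> 'a::real_inner"
  assumes step: "\<And>k. z (Suc k) = z k - (\<gamma> k / norm (T k)) *\<^sub>R T k"
    and T_nonzero: "\<And>k. T k \<noteq> 0" and T_le: "\<And>k. norm (T k) \<le> M"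
    and \<gamma>: "\<And>k. 0 \<le> \<gamma> k" and inner_nonneg: "\<And>k. 0 \<le> T k \<bullet> (z k - w)"
    and S: "(norm (z 0 - w))\<^sup>2 + (\<Sum>k\<le>K. (\<gamma> k)\<^sup>2) \<le> S"
  obtains k where "k \<le> K" "(T k \<bullet> (z k - w)) * (\<Sum>k\<le>K. \<gamma> k) \<le> M * S / 2"
proof -
  define D where "D k = T k \<bullet> (z k - w)" for k
  obtain k where "k \<le> K" and k: "\<And>j. j \<le> K \<Longrightarrow> D k \<le> D j"
    using arg_min_if_finite[of "{..K}" D] by (metis atMost_iff empty_iff finite_atMost linorder_not_le order_refl)
  have "M > 0"
    using T_nonzero[of 0] T_le[of 0] by (meson less_le_trans zero_less_norm_iff)
  have "D k * (\<Sum>j\<le>K. \<gamma> j) / M = (\<Sum>j\<le>K. \<gamma> j * D k / M)"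
    by (simp add: sum_distrib_left sum_divide_distrib mult.commute)
  also have "\<dots> \<le> (\<Sum>j\<le>K. \<gamma> j * D j / norm (T j))"
    using k T_nonzero T_le \<gamma> inner_nonneg
    by (intro sum_mono frac_le mult_left_mono) (auto simp: D_def)
  also have "\<dots> \<le> S / 2"
    using normalized_step_telescope[where n = "Suc K" and z = z and T = T and \<gamma> = \<gamma> and w = w, OF step T_nonzero] S
      zero_le_power2[of "norm (z (Suc K) - w)"]
    unfolding D_def lessThan_Suc_atMost by linarith
  finally show thesis
    using that[OF \<open>k \<le> K\<close>] \<open>M > 0\<close> by (simp add: D_def field_simps)
qed

section \<open>Inequalities for real powers\<close>

lemma powr_le_imp_le_powr_inverse:
  fixes u :: real
  assumes "u powr s \<le> t" "0 \<le> u" "0 < s"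
  shows "u \<le> t powr (1 / s)"
proof -
  have "u = (u powr s) powr (1 / s)"
    using assms by (simp add: powr_powr)
  also have "\<dots> \<le> t powr (1 / s)"
    using assms by (intro powr_mono2) auto
  finally show ?thesis .
qed

text \<open>This inverts the rate \<open>H * y powr (- a)\<close>: the threshold on \<open>y\<close>
  is the point at which the rate equals \<epsilon>.\<close>

lemma mult_powr_le_of_powr_le:
  fixes H \<epsilon> a y :: real
  assumes "0 < H" "0 < \<epsilon>" "0 < a" "H powr (1 / a) * \<epsilon> powr (- (1 / a)) \<le> y"
  shows "H * y powr (- a) \<le> \<epsilon>"
proof -
  have "(H powr (1 / a)) powr a = H" "(\<epsilon> powr (- (1 / a))) powr a = 1 / \<epsilon>"
    unfolding powr_powr using assms by (simp_all add: powr_minus_divide)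
  then have "H / \<epsilon> = (H powr (1 / a) * \<epsilon> powr (- (1 / a))) powr a"
    by (simp add: powr_mult)
  also have "\<dots> \<le> y powr a"
    using assms by (intro powr_mono2) auto
  finally have le: "H / \<epsilon> \<le> y powr a" .
  then have "0 < y powr a"
    using assms by (meson divide_pos_pos less_le_trans)
  then show ?thesis
    using le assms by (simp add: powr_minus field_simps)
qed

text \<open>The summands decrease in \<open>k\<close>, so the sum is at least \<open>K + 1\<close>
  copies of the last one.\<close>

lemma sum_powr_ge:
  assumes "p \<le> 0"
  shows "real (K + 1) powr (p + 1) \<le> (\<Sum>k\<le>K. real (k + 1) powr p)"
proof -
  have "real (K + 1) powr (p + 1) = (\<Sum>k\<le>K. real (K + 1) powr p)"
    by (simp add: powr_add)
  also have "\<dots> \<le> (\<Sum>k\<le>K. real (k + 1) powr p)"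
    using assms by (intro sum_mono powr_mono2') auto
  finally show ?thesis .
qed

section \<open>Convergence rate of the method\<close>

theorem theorem5p2:
  fixes f0 :: "real^'n \<Rightarrow> real"
    and f :: "'m::finite \<Rightarrow> real^'n \<Rightarrow> real"
    and A :: "real^'n^'l" and b :: "real^'l"
    and xstar :: "real^'n" and lamstar :: "real^'m" and nustar :: "real^'l"
    and s \<rho> \<delta> :: real
    and x :: "nat \<Rightarrow> real^'n" and lam :: "nat \<Rightarrow> real^'m" and nu :: "nat \<Rightarrow> real^'l"
    and g0 :: "nat \<Rightarrow> real^'n" and g :: "nat \<Rightarrow> 'm \<Rightarrow> real^'n"
    and T :: "nat \<Rightarrow> (real^'n) \<times> (real^'m) \<times> (real^'l)"
    and \<alpha> \<gamma> :: "nat \<Rightarrow> real"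
  assumes convex_f0: "convex_on UNIV f0"
    and convex_f: "\<And>i. convex_on UNIV (f i)"
    and primal_opt: "primal_optimal f0 f A b xstar"
    and subgradients_f0: "subgradients_bounded_on_compacts f0"
    and subgradients_f: "\<And>i. subgradients_bounded_on_compacts (f i)"
    and values_f: "\<And>i. values_bounded_on_compacts (f i)"
    and strong_duality: "primal_value f0 f A b = dual_value f0 f A b"
    and dual_opt: "dual_optimal f0 f A b lamstar nustar"
    and s: "s \<in> {1..2}" and \<rho>: "\<rho> > 0" and \<delta>: "\<delta> \<in> {0<..<1}"
    and T: "\<And>k. T k = pds_T f A b s \<rho> (x k) (lam k) (nu k) (g0 k) (g k)"
    and T_nonzero: "\<And>k. T k \<noteq> 0"
    and \<gamma>: "\<And>k. \<gamma> k = real (k + 1) powr (- 1 + \<delta> / 2)"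
    and \<alpha>: "\<And>k. \<alpha> k = \<gamma> k / norm (T k)"
    and pds: "pds_sequence f0 f A b s \<rho> \<alpha> x lam nu g0 g"
  shows "\<exists>c>0. \<forall>\<epsilon>>0. \<forall>K::nat. real K \<ge> c * \<epsilon> powr (- 2 * s / \<delta>) \<longrightarrow>
           near_feasible_indices f A b x \<epsilon> K \<noteq> {} \<and>
           ereal (best_value f0 f A b x \<epsilon> K) \<le> primal_value f0 f A b + ereal \<epsilon>"
proof -
  let ?z = "\<lambda>k. (x k, lam k, nu k)" and ?w = "(xstar, lamstar, nustar)"
  define D where "D k = T k \<bullet> (?z k - ?w)" for k
  define gap where "gap k = Lagrangian f0 f A b (x k) lamstar nustar - f0 xstar" for k
  define F where "F k = Fplus f (x k)" for k
  define r where "r k = A *v x k - b" for k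
  have g0: "g0 k \<in> subdifferential f0 (x k)"
    and g: "g k i \<in> subdifferential (\<lambda>y. Fplus f y $ i) (x k)" for k i
    using pds by (auto simp: pds_sequence_def)
  have step: "?z (Suc k) = ?z k - (\<gamma> k / norm (T k)) *\<^sub>R T k" for k
    using pds unfolding pds_sequence_def T \<alpha> by blast
  have \<gamma>_pos: "0 < \<gamma> k" for k
    by (simp add: \<gamma>)
  have lam_nonneg: "lam k \<in> nonneg_orthant" for k
  proof (induction k)
    case (Suc k)
    have "lam (Suc k) = lam k + \<alpha> k *\<^sub>R F k"
      using step[of k] by (simp add: T pds_T_def \<alpha> F_def)
    then show ?case
      using Suc \<gamma>_pos[of k] by (simp add: nonneg_orthant_def \<alpha> F_def Fplus_nonneg)
  qed (use pds in \<open>simp add: pds_sequence_def\<close>)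
  have gap_nonneg: "0 \<le> gap k" for k
    using lagrangian_ge_primal_optimum[OF primal_opt strong_duality dual_opt, of "x k"]
    by (simp add: gap_def)
  have D_ge: "gap k + \<rho> * s * (norm (F k) powr s + norm (r k) powr s) \<le> D k" for k
    unfolding D_def T gap_def F_def r_def
    using primal_opt g0 g lam_nonneg s \<rho> by (intro pds_T_inner_ge) (auto simp: primal_optimal_def)
  moreover have pen_nonneg: "0 \<le> \<rho> * s * (norm (F k) powr s + norm (r k) powr s)" for k
    using s \<rho> by simp
  ultimately have D_nonneg: "0 \<le> D k" for k
    using gap_nonneg by (meson add_nonneg_nonneg order_trans)

  \<comment> \<open>The squares have exponent \<open>- 2 + \<delta>\<close>, which lies below -1
    because \<delta> is less than 1.\<close>
  have summable: "summable (\<lambda>k. (\<gamma> k)\<^sup>2)"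
  proof -
    have "(\<gamma> k)\<^sup>2 = real (Suc k) powr (- 2 + \<delta>)" for k
      by (simp add: \<gamma> power2_eq_square flip: powr_add)
    moreover have "summable (\<lambda>k. real (Suc k) powr (- 2 + \<delta>))"
      using \<delta> by (subst summable_Suc_iff) (simp add: summable_real_powr_iff)
    ultimately show ?thesis
      by simp
  qed
  \<comment> \<open>With the full series, \<open>S\<close> bounds the right-hand side of the
    telescoped identity for all horizons at once; \<open>R\<close> and \<open>M\<close> therefore do
    not depend on \<open>K\<close>.\<close>
  define S where "S = (norm (?z 0 - ?w))\<^sup>2 + (\<Sum>k. (\<gamma> k)\<^sup>2)"
  have S_ge: "(norm (?z 0 - ?w))\<^sup>2 + (\<Sum>k\<in>I. (\<gamma> k)\<^sup>2) \<le> S" if "finite I" for I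
    using sum_le_suminf[OF summable that] by (simp add: S_def)
  have "0 \<le> S"
    using S_ge[of "{}"] by (simp add: order_trans[OF zero_le_power2])
  define R where "R = norm ?w + sqrt S"
  have R: "0 \<le> R"
    using \<open>0 \<le> S\<close> by (simp add: R_def)
  have z_le: "norm (?z n) \<le> R" for n
  proof -
    have "0 \<le> (\<Sum>k<n. \<gamma> k * D k / norm (T k))"
      using D_nonneg \<gamma>_pos by (intro sum_nonneg) (simp add: less_imp_le)
    then have "(norm (?z n - ?w))\<^sup>2 \<le> S"
      using normalized_step_telescope[where n = n and z = ?z and T = T and \<gamma> = \<gamma> and w = ?w,
          OF step T_nonzero] S_ge[of "{..<n}"]
      unfolding D_def by auto
    then have "norm (?z n - ?w) \<le> sqrt S"
      by (rule real_le_rsqrt)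
    then show ?thesis
      unfolding R_def using norm_triangle_sub[of "?z n" ?w] by linarith
  qed
  have "norm (x n) \<le> R" "norm (lam n) \<le> R" "norm (nu n) \<le> R" for n
    using z_le[of n] norm_fst_le[of "x n" "(lam n, nu n)"] norm_snd_le[of "(lam n, nu n)" "x n"]
      norm_fst_le[of "lam n" "nu n"] norm_snd_le[of "nu n" "lam n"] by linarith+
  then obtain M where "M > 0" and T_le: "norm (T k) \<le> M" for k
    using pds_T_bounded[where f = f and R = R and A = A and b = b,
        OF subgradients_f0 values_f s less_imp_le[OF \<rho>] R] g0 g
    unfolding T by metis

  \<comment> \<open>\<open>C\<close> bounds the least \<open>D k\<close> times the sum of the step
    parameters. \<open>E\<close> arises from solving
    \<open>\<rho> * s * u powr s \<le> C * q powr s\<close> for \<open>u\<close>. \<open>H\<close>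
    dominates both the residual constant \<open>2 * E\<close> and the objective constant
    \<open>C + (norm lamstar + norm nustar) * E\<close>; the summand 1 keeps it positive. The
    exponent \<open>a\<close> is chosen so that \<open>q powr s\<close> decays like
    \<open>K powr (- \<delta> / 2)\<close>.\<close>
  define C where "C = M * S / 2"
  define E where "E = (C / (\<rho> * s)) powr (1 / s)"
  define H where "H = 1 + 2 * E + C + (norm lamstar + norm nustar) * E"
  define a where "a = \<delta> / (2 * s)"
  have "0 \<le> C" "0 \<le> E" "0 < a"
    using \<open>M > 0\<close> \<open>0 \<le> S\<close> s \<delta> by (simp_all add: C_def E_def a_def)
  then have "0 < H"
    unfolding H_def by (intro add_pos_nonneg) auto
  have rate: "\<exists>k\<le>K. norm (F k) + norm (r k) \<le> H * q \<and> f0 (x k) \<le> f0 xstar + H * q"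
    if q: "q = real (K + 1) powr (- a)" for K q
  proof -
    have "0 < q" "q \<le> 1"
      using \<open>0 < a\<close> powr_mono[of "- a" 0 "real (K + 1)"] by (simp_all add: q)
    have qs: "q powr s = real (K + 1) powr (- (\<delta> / 2))"
      using s by (simp add: q a_def powr_powr)
    \<comment> \<open>Since \<open>q\<close> is at most 1 and \<open>s\<close> at least 1, the
      Lagrangian gap, of order \<open>q powr s\<close>, is absorbed into the order \<open>q\<close>
      of the residuals.\<close>
    have "q powr s \<le> q"
      using powr_mono'[of 1 s q] s \<open>0 < q\<close> \<open>q \<le> 1\<close> by simp
    obtain k where "k \<le> K" and k: "D k * (\<Sum>k\<le>K. \<gamma> k) \<le> C"
      using normalized_step_min_inner_le[where z = ?z and T = T and \<gamma> = \<gamma> and w = ?w and K = K,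
          OF step T_nonzero T_le less_imp_le[OF \<gamma>_pos] D_nonneg[unfolded D_def] S_ge]
      unfolding C_def D_def by auto
    have "real (K + 1) powr (\<delta> / 2) \<le> (\<Sum>k\<le>K. \<gamma> k)"
      using sum_powr_ge[of "- 1 + \<delta> / 2" K] \<delta> by (simp add: \<gamma>)
    then have "D k * real (K + 1) powr (\<delta> / 2) \<le> C"
      using k D_nonneg[of k] by (meson mult_left_mono order_trans)
    then have D_le: "D k \<le> C * q powr s"
      unfolding qs by (simp add: powr_minus field_simps)
    have bound: "u \<le> E * q" if "\<rho> * s * u powr s \<le> D k" "0 \<le> u" for u
    proof -
      have "u powr s \<le> C / (\<rho> * s) * q powr s"
        using that(1) D_le s \<rho> by (simp add: field_simps)
      then have "u \<le> (C / (\<rho> * s) * q powr s) powr (1 / s)"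
        using that(2) s by (intro powr_le_imp_le_powr_inverse) auto
      also have "\<dots> = E * q"
        unfolding E_def powr_mult powr_powr using s \<open>0 < q\<close> by simp
      finally show ?thesis .
    qed
    have pens: "0 \<le> \<rho> * s * norm (F k) powr s" "0 \<le> \<rho> * s * norm (r k) powr s"
      using s \<rho> by simp_all
    have D_ge': "gap k + (\<rho> * s * norm (F k) powr s + \<rho> * s * norm (r k) powr s) \<le> D k"
      using D_ge[of k] by (simp add: distrib_left)
    have F_le: "norm (F k) \<le> E * q" and r_le: "norm (r k) \<le> E * q"
      using D_ge' pens gap_nonneg[of k] by (auto intro!: bound)
    \<comment> \<open>The objective gap differs from the Lagrangian gap only by multiplier terms,
      which Cauchy-Schwarz bounds by the residuals at the same index \<open>k\<close>.\<close>
    have "f0 (x k) - f0 xstar = gap k - lamstar \<bullet> F k - nustar \<bullet> r k"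
      by (simp add: gap_def Lagrangian_def F_def r_def)
    also have "\<dots> \<le> C * q + norm lamstar * (E * q) + norm nustar * (E * q)"
    proof -
      have "gap k \<le> C * q powr s"
        using D_ge' pens D_le by linarith
      also have "\<dots> \<le> C * q"
        using \<open>q powr s \<le> q\<close> \<open>0 \<le> C\<close> by (rule mult_left_mono)
      finally have "gap k \<le> C * q" .
      moreover have "- (lamstar \<bullet> F k) \<le> norm lamstar * (E * q)"
        using Cauchy_Schwarz_ineq2[of lamstar "F k"] mult_left_mono[OF F_le norm_ge_zero[of lamstar]]
        by linarith
      moreover have "- (nustar \<bullet> r k) \<le> norm nustar * (E * q)"
        using Cauchy_Schwarz_ineq2[of nustar "r k"] mult_left_mono[OF r_le norm_ge_zero[of nustar]]
        by linarith
      ultimately show ?thesis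
        by linarith
    qed
    also have "\<dots> \<le> H * q"
      using \<open>0 < q\<close> \<open>0 \<le> E\<close> by (simp add: H_def algebra_simps)
    finally have "f0 (x k) \<le> f0 xstar + H * q"
      by simp
    moreover have "2 * E * q \<le> H * q"
      using \<open>0 < q\<close> \<open>0 \<le> E\<close> \<open>0 \<le> C\<close> by (intro mult_right_mono) (auto simp: H_def)
    then have "norm (F k) + norm (r k) \<le> H * q"
      using F_le r_le by simp
    ultimately show ?thesis
      using \<open>k \<le> K\<close> by blast
  qed

  show ?thesis
  \<comment> \<open>Here \<open>1 / a\<close> is \<open>2 * s / \<delta>\<close>, the exponent in
    the claim, and \<open>H\<close> depends on neither \<epsilon> nor \<open>K\<close>.\<close>
  proof (intro exI[of _ "H powr (1 / a)"] conjI allI impI)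
    show "0 < H powr (1 / a)"
      using \<open>0 < H\<close> by simp
  next
    fix \<epsilon> :: real and K :: nat
    assume \<epsilon>: "\<epsilon> > 0" and K: "H powr (1 / a) * \<epsilon> powr (- 2 * s / \<delta>) \<le> real K"
    let ?I = "near_feasible_indices f A b x \<epsilon> K"
    \<comment> \<open>The rate is stated in \<open>K + 1\<close>, so a bound on \<open>K\<close> is
      more than enough, also for \<open>K = 0\<close>.\<close>
    have "H powr (1 / a) * \<epsilon> powr (- (1 / a)) \<le> real (K + 1)"
      using K by (simp add: a_def)
    then have "H * real (K + 1) powr (- a) \<le> \<epsilon>"
      by (rule mult_powr_le_of_powr_le[OF \<open>0 < H\<close> \<epsilon> \<open>0 < a\<close>])
    then obtain k where "k \<le> K" "norm (F k) + norm (r k) \<le> \<epsilon>" and k: "f0 (x k) \<le> f0 xstar + \<epsilon>"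
      using rate[OF refl, of K] by fastforce
    then have mem: "k \<in> ?I"
      by (simp add: near_feasible_indices_def F_def r_def)
    then show "?I \<noteq> {}"
      by blast
    have "finite ?I"
      by (simp add: near_feasible_indices_def)
    then have "best_value f0 f A b x \<epsilon> K \<le> f0 (x k)"
      unfolding best_value_def using mem by (intro Min_le) auto
    then have "best_value f0 f A b x \<epsilon> K \<le> f0 xstar + \<epsilon>"
      using k by linarith
    moreover have "primal_value f0 f A b = ereal (f0 xstar)"
      using primal_opt by (simp add: primal_optimal_def)
    ultimately show "ereal (best_value f0 f A b x \<epsilon> K) \<le> primal_value f0 f A b + ereal \<epsilon>"
      by simp
  qed
qed

end
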